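(* Let $G$ be a finite abelian group with chain $1\subset G$. The ring morphism $\iota:R(G)\to R(\widetilde G)$, $\chi_g\mapsto\chi_{\{g\}}$, defines an integral ring extension (i.e. $\iota$ is injective and $R(\widetilde G)$ is integral over $\iota(R(G))$).
   Context: Fix an isomorphism of $G$ with its character group; for $g\in G$ let $T_g$ be the corresponding one-dimensional complex representation, so $T_g\otimes T_h\cong T_{gh}$. $R(G)$ is the representation ring of $G$, with $\mathbb{Z}$-basis the characters $\chi_g$ of $T_g$ and $\chi_g\chi_h=\chi_{gh}$. $R(\widetilde G)$, the generalized character ring for the chain $1\subset G$, is the free $\mathbb{Z}$-module with basis $\chi_A$, $A$ running over all subsets of $G$. For $A\neq\emptyset$, $\chi_A$ is the character of the irreducible glider $\bigoplus_{g\in A}T_g\supset\mathbb{C}\sum_{g\in A}t_g\supset0\supset\cdots$ ($0\ne t_g\in T_g$), and $\chi_\emptyset$ is that of $\mathbb{C}\supset0\supset\cdots$. The multiplication is given by the tensor product of gliders (componentwise tensor product of the chains), decomposed into irreducible gliders. Explicitly, for nonempty $A,B$, $$\chi_A\chi_B=\chi_{AB}+(|A||B|-|AB|)\chi_\emptyset,\qquad AB=\{gh:g\in A,h\in B\},$$ and $\chi_A\chi_\emptyset=|A|\chi_\emptyset$, $\chi_\emptyset^2=\chi_\emptyset$. The unit element is $\chi_{\{1\}}$. *)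

theory Defs
  imports "HOL-Algebra.Algebra" Complex_Main
begin

definition complex_units :: "complex monoid" where
  "complex_units = \<lparr>carrier = UNIV - {0}, monoid.mult = (*), one = 1\<rparr>"

text \<open>
  The group of one-dimensional complex characters of \<open>G\<close> under the pointwise product, which is
  the character of the tensor product. Characters are functions on \<open>carrier G\<close>, so they are
  normalised to be \<open>undefined\<close> outside it.
\<close>

definition character_group ::
  "('a, 'm) monoid_scheme \<Rightarrow> ('a \<Rightarrow> complex) monoid" where
  "character_group G =
     \<lparr>carrier = hom G complex_units \<inter> extensional (carrier G),
      monoid.mult = (\<lambda>\<chi> \<psi>. \<lambda>x\<in>carrier G. \<chi> x * \<psi> x),
      one = (\<lambda>x\<in>carrier G. 1)\<rparr>"

text \<open>
  The representation ring of a finite abelian group, as the ring of virtual characters: the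
  integer combinations of the irreducible characters, which are all one-dimensional, inside the
  ring of complex-valued functions on \<open>G\<close>.
\<close>

definition representation_ring ::
  "('a, 'm) monoid_scheme \<Rightarrow> ('a \<Rightarrow> complex) ring" where
  "representation_ring G =
     \<lparr>carrier = {F. \<exists>c :: ('a \<Rightarrow> complex) \<Rightarrow> int.
                 F = (\<lambda>x\<in>carrier G. \<Sum>\<chi>\<in>carrier (character_group G). of_int (c \<chi>) * \<chi> x)},
      monoid.mult = (\<lambda>F H. \<lambda>x\<in>carrier G. F x * H x),
      one = (\<lambda>x\<in>carrier G. 1),
      ring.zero = (\<lambda>x\<in>carrier G. 0),
      ring.add = (\<lambda>F H. \<lambda>x\<in>carrier G. F x + H x)\<rparr>"

text \<open>
  The product of two basis elements of the generalized character ring for the chain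
  \<open>1 \<subset> G\<close>. Here \<open>frag_of A\<close> is the glider character \<open>\<chi>\<^sub>A\<close>. The tensor product of the gliders
  attached to nonempty \<open>A\<close> and \<open>B\<close> has dimension \<open>|A| |B|\<close>; the glider attached to
  \<open>A <#> B\<close> accounts for \<open>|A <#> B|\<close> of it, and the rest is a sum of copies of the glider
  \<open>\<complex> \<supset> 0 \<supset> \<dots>\<close>, whose index is the empty set although it is one-dimensional.
\<close>

definition glider_basis_mult ::
  "('a, 'm) monoid_scheme \<Rightarrow> 'a set \<Rightarrow> 'a set \<Rightarrow> ('a set \<Rightarrow>\<^sub>0 int)" where
  "glider_basis_mult G A B =
     (if A = {} \<and> B = {} then frag_of {}
      else if B = {} then frag_cmul (int (card A)) (frag_of {})
      else if A = {} then frag_cmul (int (card B)) (frag_of {})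
      else frag_of (A <#>\<^bsub>G\<^esub> B)
           + frag_cmul (int (card A) * int (card B) - int (card (A <#>\<^bsub>G\<^esub> B))) (frag_of {}))"

definition glider_character_ring ::
  "('a, 'm) monoid_scheme \<Rightarrow> ('a set \<Rightarrow>\<^sub>0 int) ring" where
  "glider_character_ring G =
     \<lparr>carrier = carrier (free_Abelian_group (Pow (carrier G))),
      monoid.mult = (\<lambda>x y. frag_extend (\<lambda>A. frag_extend (\<lambda>B. glider_basis_mult G A B) y) x),
      one = frag_of {\<one>\<^bsub>G\<^esub>},
      ring.zero = 0,
      ring.add = (+)\<rparr>"

text \<open>
  In HOL-Algebra a polynomial is a list of coefficients with the leading coefficient first.
\<close>

definition integral_over :: "('b, 'n) ring_scheme \<Rightarrow> 'b set \<Rightarrow> 'b \<Rightarrow> bool" where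
  "integral_over S K s \<longleftrightarrow>
     (\<exists>p \<in> carrier (K[X]\<^bsub>S\<^esub>). p \<noteq> [] \<and> lead_coeff p = \<one>\<^bsub>S\<^esub> \<and> ring.eval S p s = \<zero>\<^bsub>S\<^esub>)"

definition integral_ring_extension ::
  "('a, 'm) ring_scheme \<Rightarrow> ('b, 'n) ring_scheme \<Rightarrow> ('a \<Rightarrow> 'b) \<Rightarrow> bool" where
  "integral_ring_extension R S \<iota> \<longleftrightarrow>
     cring R \<and> cring S \<and> \<iota> \<in> ring_hom R S \<and> inj_on \<iota> (carrier R) \<and>
     (\<forall>s\<in>carrier S. integral_over S (\<iota> ` carrier R) s)"

end

theory Submission
  imports Defs
begin

text \<open>
  By orthogonality of characters, the coefficients of a virtual character are determined by its
  values, so \<open>\<iota>\<close> exists and is injective. The glider character ring is finitely generated as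
  an abelian group; hence the ascending chain of the subgroups generated by
  \<open>1, s, \<dots>, s\<^sup>k\<close> is stationary, some power of \<open>s\<close> is an integer combination of lower ones,
  and \<open>s\<close> is integral already over the integers.
\<close>

section \<open>Subgroups of free abelian groups, seen as spans over the integers\<close>

interpretation frag: Modules.module "frag_cmul :: int \<Rightarrow> ('a \<Rightarrow>\<^sub>0 int) \<Rightarrow> ('a \<Rightarrow>\<^sub>0 int)"
  by unfold_locales (simp_all add: frag_cmul_distrib frag_cmul_distrib2)

text \<open>A combination involves finitely many terms of the sequence, so some bound exceeds all
  their indices.\<close>

lemma span_range_eq_Union:
  fixes v :: "nat \<Rightarrow> ('a \<Rightarrow>\<^sub>0 int)"
  assumes "x \<in> frag.span (range v)"
  shows "\<exists>n. x \<in> frag.span (v ` {..<n})"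
  using assms
proof (induction rule: frag.span_induct_alt)
  case base
  show ?case by (auto intro: frag.span_zero)
next
  case (step c x y)
  then obtain k n where x: "x = v k" and y: "y \<in> frag.span (v ` {..<n})" by auto
  have "v ` {..<n} \<subseteq> v ` {..<max n (Suc k)}" by auto
  then have "y \<in> frag.span (v ` {..<max n (Suc k)})"
    using y frag.span_mono by blast
  moreover have "x \<in> frag.span (v ` {..<max n (Suc k)})"
    unfolding x by (rule frag.span_base) auto
  ultimately show ?case
    by (blast intro: frag.span_add frag.span_scale)
qed

text \<open>
  This is the Noetherian property of finitely generated free abelian groups. Induction on the rank:
  a span element with least positive coordinate at \<open>a\<close> clears that coordinate from
  all later terms of the sequence.
\<close>

lemma frag_sequence_dependent:
  fixes v :: "nat \<Rightarrow> ('a \<Rightarrow>\<^sub>0 int)"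
  assumes "finite I" and "\<And>k. Poly_Mapping.keys (v k) \<subseteq> I"
  shows "\<exists>k. v k \<in> frag.span (v ` {..<k})"
  using assms
proof (induction I arbitrary: v rule: finite_induct)
  case empty
  then have "v 0 = 0" by simp
  then show ?case by (metis frag.span_zero)
next
  case (insert a I)
  let ?M = "frag.span (range v)"
  show ?case
  proof (cases "\<forall>x\<in>?M. Poly_Mapping.lookup x a = 0")
    case True
    then have "Poly_Mapping.keys (v k) \<subseteq> I" for k
      using insert.prems[of k] frag.span_base[of "v k" "range v"] by (auto simp: in_keys_iff)
    then show ?thesis by (rule insert.IH)
  next
    case False
    then obtain x where x: "x \<in> ?M" "Poly_Mapping.lookup x a \<noteq> 0" by blast
    define P where "P y \<longleftrightarrow> y \<in> ?M \<and> 0 < Poly_Mapping.lookup y a" for y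
    have "P x \<or> P (- x)"
      using x by (auto simp: P_def frag.span_neg)
    then obtain w where w: "P w"
      and w_min: "\<And>y. P y \<Longrightarrow> nat (Poly_Mapping.lookup w a) \<le> nat (Poly_Mapping.lookup y a)"
      using exists_least_iff[of "\<lambda>n. \<exists>y. P y \<and> n = nat (Poly_Mapping.lookup y a)"]
      by (metis linorder_not_le)
    \<comment> \<open>Division with remainder: at \<open>a\<close> the coordinate of
      \<open>u y\<close> is that of \<open>y\<close> reduced modulo that of \<open>w\<close>. It is
      nonnegative and below the minimum, so it vanishes.\<close>
    define u where "u y = y - frag_cmul (Poly_Mapping.lookup y a div Poly_Mapping.lookup w a) w" for y
    have u_a: "Poly_Mapping.lookup (u y) a = 0" if "y \<in> ?M" for y
    proof -
      have "u y \<in> ?M"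
        using that w by (auto simp: u_def P_def intro: frag.span_diff frag.span_scale)
      moreover have "Poly_Mapping.lookup (u y) a = Poly_Mapping.lookup y a mod Poly_Mapping.lookup w a"
        by (simp add: u_def lookup_minus minus_div_mult_eq_mod)
      ultimately show ?thesis
        using w_min[of "u y"] w pos_mod_bound[of "Poly_Mapping.lookup w a" "Poly_Mapping.lookup y a"]
          pos_mod_sign[of "Poly_Mapping.lookup w a" "Poly_Mapping.lookup y a"]
        unfolding P_def by linarith
    qed
    \<comment> \<open>From index \<open>N\<close> on, subtracting multiples of \<open>w\<close> does
      not leave the span of the earlier terms. Hence a dependence in the reduced tail gives one in
      \<open>v\<close>.\<close>
    obtain N where N: "w \<in> frag.span (v ` {..<N})"
      using span_range_eq_Union w unfolding P_def by blast
    have "Poly_Mapping.keys (u (v (N + k))) \<subseteq> I" for k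
    proof -
      have "Poly_Mapping.keys (u (v (N + k))) \<subseteq> insert a I"
      proof -
        have "Poly_Mapping.keys w \<subseteq> insert a I"
        proof -
          have "w \<in> {y. Poly_Mapping.keys y \<subseteq> insert a I}"
          proof (rule subsetD[OF frag.span_minimal])
            show "w \<in> ?M" using w by (simp add: P_def)
            show "frag.subspace {y. Poly_Mapping.keys y \<subseteq> insert a I}"
            proof (rule frag.subspaceI)
            qed (use keys_add in fastforce)+
          qed (use insert.prems in auto)
          then show ?thesis by simp
        qed
        then show ?thesis
          unfolding u_def
          using keys_diff[of "v (N + k)"] keys_cmul[of _ w] insert.prems[of "N + k"] by fast
      qed
      moreover have "a \<notin> Poly_Mapping.keys (u (v (N + k)))"
        using u_a[of "v (N + k)"] by (simp add: in_keys_iff frag.span_base)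
      ultimately show ?thesis by auto
    qed
    then obtain k where k: "u (v (N + k)) \<in> frag.span ((\<lambda>k. u (v (N + k))) ` {..<k})"
      using insert.IH[of "\<lambda>k. u (v (N + k))"] by blast
    let ?L = "frag.span (v ` {..<N + k})"
    have w_L: "w \<in> ?L"
    proof (rule subsetD[OF frag.span_mono N])
      show "v ` {..<N} \<subseteq> v ` {..<N + k}" by auto
    qed
    have "(\<lambda>k. u (v (N + k))) ` {..<k} \<subseteq> ?L"
      unfolding u_def by (auto intro!: frag.span_diff frag.span_scale w_L intro: frag.span_base)
    then have "u (v (N + k)) \<in> ?L"
      using k frag.span_minimal[OF _ frag.subspace_span] by blast
    then have "u (v (N + k)) + frag_cmul (Poly_Mapping.lookup (v (N + k)) a div Poly_Mapping.lookup w a) w \<in> ?L"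
      by (intro frag.span_add frag.span_scale w_L)
    then have "v (N + k) \<in> ?L"
      by (simp add: u_def)
    then show ?thesis ..
  qed
qed

section \<open>The commutative ring of glider characters\<close>

text \<open>
  With the glider indexed by the empty set counted as one-dimensional, a single formula covers
  all four cases of the product of basis elements, and associativity needs no case distinction.
\<close>

definition glider_dim :: "'a set \<Rightarrow> int" where
  "glider_dim A = (if A = {} then 1 else int (card A))"

text \<open>If \<open>A\<close> or \<open>B\<close> is empty, so is \<open>A <#> B\<close>, and the
  two summands combine to \<open>glider_dim A * glider_dim B\<close> copies of
  \<open>frag_of {}\<close>.\<close>

lemma glider_basis_mult_eq:
  "glider_basis_mult G A B =
     frag_of (A <#>\<^bsub>G\<^esub> B)
     + frag_cmul (glider_dim A * glider_dim B - glider_dim (A <#>\<^bsub>G\<^esub> B)) (frag_of {})"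
  by (auto simp: glider_basis_mult_def glider_dim_def frag_cmul_diff_distrib set_mult_def)

text \<open>Separating the product from the ring record allows bilinearity to be proved for all
  formal sums, without carrier conditions.\<close>

definition glider_mult ::
  "('a, 'm) monoid_scheme \<Rightarrow> ('a set \<Rightarrow>\<^sub>0 int) \<Rightarrow> ('a set \<Rightarrow>\<^sub>0 int) \<Rightarrow> ('a set \<Rightarrow>\<^sub>0 int)" where
  "glider_mult G x y = frag_extend (\<lambda>A. frag_extend (\<lambda>B. glider_basis_mult G A B) y) x"

lemma glider_character_ring_simps [simp]:
  "carrier (glider_character_ring G) = {x. Poly_Mapping.keys x \<subseteq> Pow (carrier G)}"
  "x \<otimes>\<^bsub>glider_character_ring G\<^esub> y = glider_mult G x y"
  "\<one>\<^bsub>glider_character_ring G\<^esub> = frag_of {\<one>\<^bsub>G\<^esub>}"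
  "\<zero>\<^bsub>glider_character_ring G\<^esub> = 0"
  "x \<oplus>\<^bsub>glider_character_ring G\<^esub> y = x + y"
  by (simp_all add: glider_character_ring_def glider_mult_def free_Abelian_group_def)

lemma glider_mult_frag_of [simp]:
  "glider_mult G (frag_of A) (frag_of B) = glider_basis_mult G A B"
  by (simp add: glider_mult_def)

lemma glider_mult_0 [simp]: "glider_mult G 0 y = 0" "glider_mult G x 0 = 0"
  by (simp_all add: glider_mult_def frag_extend_def)

lemma glider_mult_add:
  "glider_mult G (x + y) z = glider_mult G x z + glider_mult G y z"
  "glider_mult G x (y + z) = glider_mult G x y + glider_mult G x z"
  by (simp_all add: glider_mult_def frag_extend_add) (simp add: frag_extend_def frag_cmul_distrib2 sum.distrib)

lemma glider_mult_cmul: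
  "glider_mult G (frag_cmul n x) y = frag_cmul n (glider_mult G x y)"
  "glider_mult G x (frag_cmul n y) = frag_cmul n (glider_mult G x y)"
  by (simp_all add: glider_mult_def frag_extend_cmul)
    (simp add: frag_extend_def frag_cmul_sum mult.left_commute)

lemma glider_mult_diff:
  "glider_mult G (x - y) z = glider_mult G x z - glider_mult G y z"
  "glider_mult G x (y - z) = glider_mult G x y - glider_mult G x z"
  using glider_mult_add(1)[of G "x - y" y z] glider_mult_add(2)[of G x "y - z" z]
  by (simp_all add: algebra_simps)

lemma glider_mult_sum:
  "glider_mult G (sum f I) y = (\<Sum>i\<in>I. glider_mult G (f i) y)"
  "glider_mult G x (sum f I) = (\<Sum>i\<in>I. glider_mult G x (f i))"
  by (induction I rule: infinite_finite_induct) (simp_all add: glider_mult_add)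

text \<open>A factor \<open>C\<close> multiplies \<open>frag_of {}\<close> by
  \<open>glider_dim C\<close>. On both sides the terms in \<open>glider_dim (A <#> B)\<close> or
  \<open>glider_dim (B <#> C)\<close> cancel, and the coefficient of the correction is the product
  of the three dimensions minus that of the triple product set.\<close>

lemma glider_basis_mult_assoc:
  assumes "group G" "A \<subseteq> carrier G" "B \<subseteq> carrier G" "C \<subseteq> carrier G"
  shows "glider_mult G (glider_basis_mult G A B) (frag_of C) =
    glider_mult G (frag_of A) (glider_basis_mult G B C)"
proof -
  interpret group G by fact
  have left: "glider_basis_mult G {} C = frag_cmul (glider_dim C) (frag_of {})" for C
    by (simp add: glider_basis_mult_def glider_dim_def)
  have right: "glider_basis_mult G A {} = frag_cmul (glider_dim A) (frag_of {})" for A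
    by (simp add: glider_basis_mult_def glider_dim_def)
  show ?thesis
    unfolding glider_basis_mult_eq[of G A B] glider_basis_mult_eq[of G B C]
      glider_mult_add glider_mult_cmul glider_mult_frag_of left right
    by (rule poly_mapping_eqI)
      (simp add: glider_basis_mult_eq set_mult_assoc assms lookup_add algebra_simps)
qed

text \<open>By bilinearity the laws of multiplication need checking on basis elements only. The
  inductive step of \<open>frag_induction\<close> concerns differences, which
  \<open>glider_mult_diff\<close> handles.\<close>

lemma cring_glider_character_ring:
  assumes "comm_group G"
  shows "cring (glider_character_ring G)"
proof -
  interpret comm_group G by fact
  let ?S = "Pow (carrier G)"
  have comm: "A <#>\<^bsub>G\<^esub> B = B <#>\<^bsub>G\<^esub> A" if "A \<in> ?S" "B \<in> ?S" for A B
    using that by (auto simp: set_mult_def) (metis m_comm subsetD)+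
  have closed: "Poly_Mapping.keys (glider_mult G x y) \<subseteq> ?S"
    if "Poly_Mapping.keys x \<subseteq> ?S" "Poly_Mapping.keys y \<subseteq> ?S" for x y
  proof -
    have "Poly_Mapping.keys (glider_basis_mult G A B) \<subseteq> ?S" if "A \<in> ?S" "B \<in> ?S" for A B
    proof -
      have "A <#>\<^bsub>G\<^esub> B \<in> ?S" using that set_mult_closed by auto
      then show ?thesis
        unfolding glider_basis_mult_eq using keys_add by fastforce
    qed
    then show ?thesis
      using that unfolding glider_mult_def
      by (blast dest!: subsetD[OF keys_frag_extend])
  qed
  have m_comm: "glider_mult G x y = glider_mult G y x"
    if "Poly_Mapping.keys x \<subseteq> ?S" "Poly_Mapping.keys y \<subseteq> ?S" for x y
    using that(1)
  proof (induction x rule: frag_induction)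
    case (one A)
    show ?case
      using that(2)
      by (induction y rule: frag_induction)
        (use one in \<open>simp_all add: glider_mult_diff glider_basis_mult_eq comm mult.commute\<close>)
  qed (simp_all add: glider_mult_diff)
  have m_assoc: "glider_mult G (glider_mult G x y) z = glider_mult G x (glider_mult G y z)"
    if "Poly_Mapping.keys x \<subseteq> ?S" "Poly_Mapping.keys y \<subseteq> ?S" "Poly_Mapping.keys z \<subseteq> ?S" for x y z
    using that(1)
  proof (induction x rule: frag_induction)
    case (one A)
    show ?case
      using that(2)
    proof (induction y rule: frag_induction)
      case (one B)
      show ?case
        using that(3)
        by (induction z rule: frag_induction)
          (use one \<open>A \<in> ?S\<close> in \<open>simp_all add: glider_mult_diff glider_basis_mult_assoc[OF is_group]\<close>)
    qed (simp_all add: glider_mult_diff)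
  qed (simp_all add: glider_mult_diff)
  have l_one: "glider_mult G (frag_of {\<one>\<^bsub>G\<^esub>}) x = x" if "Poly_Mapping.keys x \<subseteq> ?S" for x
    using that
  proof (induction x rule: frag_induction)
    case (one A)
    then have "{\<one>\<^bsub>G\<^esub>} <#>\<^bsub>G\<^esub> A = A"
      by (force simp: set_mult_def)
    \<comment> \<open>The correction vanishes because \<open>glider_dim {\<one>}\<close> is
      1.\<close>
    then show ?case by (simp add: glider_basis_mult_eq) (simp add: glider_dim_def)
  qed (simp_all add: glider_mult_diff)
  have add_closed: "Poly_Mapping.keys (x + y) \<subseteq> ?S"
    if "Poly_Mapping.keys x \<subseteq> ?S" "Poly_Mapping.keys y \<subseteq> ?S" for x y :: "'a set \<Rightarrow>\<^sub>0 int"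
    using that keys_add[of x y] by blast
  show ?thesis
  proof (rule cringI)
    show "abelian_group (glider_character_ring G)"
    proof (rule abelian_groupI)
      fix x assume "x \<in> carrier (glider_character_ring G)"
      then show "\<exists>y\<in>carrier (glider_character_ring G). y \<oplus>\<^bsub>glider_character_ring G\<^esub> x = \<zero>\<^bsub>glider_character_ring G\<^esub>"
        by (intro bexI[of _ "- x"]) auto
    qed (simp_all add: add_closed algebra_simps)
    show "Group.comm_monoid (glider_character_ring G)"
      by (rule comm_monoidI) (simp_all add: closed m_assoc l_one, blast intro: m_comm)
  qed (simp add: glider_mult_add)
qed

section \<open>Integrality over the integers\<close>

text \<open>Since \<open>Pow (carrier G)\<close> is finite, the powers of \<open>s\<close> satisfy a
  dependence with leading coefficient 1. Its coefficients are integer multiples of the unit, so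
  \<open>K\<close> only has to contain these.\<close>

lemma integral_over_glider_character_ring:
  assumes "comm_group G" "finite (carrier G)"
    and K: "\<And>n. frag_cmul n (frag_of {\<one>\<^bsub>G\<^esub>}) \<in> K"
    and s: "s \<in> carrier (glider_character_ring G)"
  shows "integral_over (glider_character_ring G) K s"
proof -
  let ?S = "glider_character_ring G"
  interpret cring ?S by (rule cring_glider_character_ring) fact
  define v where "v k = s [^]\<^bsub>?S\<^esub> k" for k :: nat
  have v_carrier: "v k \<in> carrier ?S" for k
    unfolding v_def using s by (rule nat_pow_closed)
  \<comment> \<open>The list has length exactly \<open>n\<close>, possibly with zeros at its head,
    so that an element put in front of it becomes the coefficient of degree
    \<open>n\<close>.\<close>
  have combination: "\<exists>p. set p \<subseteq> range (\<lambda>n. frag_cmul n (frag_of {\<one>\<^bsub>G\<^esub>})) \<and> length p = n \<and> eval p s = x"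
    if "x \<in> frag.span (v ` {..<n})" for x n
    using that
  proof (induction n arbitrary: x)
    case 0
    then show ?case by (simp add: frag.span_empty)
  next
    case (Suc n)
    then obtain k where "x - frag_cmul k (v n) \<in> frag.span (v ` {..<n})"
      by (auto simp: lessThan_Suc frag.span_breakdown_eq)
    then obtain p where p: "set p \<subseteq> range (\<lambda>n. frag_cmul n (frag_of {\<one>\<^bsub>G\<^esub>}))"
      "length p = n" "eval p s = x - frag_cmul k (v n)"
      using Suc.IH by metis
    have "glider_mult G (frag_of {\<one>\<^bsub>G\<^esub>}) (v n) = v n"
      using l_one[OF v_carrier] by simp
    then have "eval (frag_cmul k (frag_of {\<one>\<^bsub>G\<^esub>}) # p) s = x"
      using p by (simp add: glider_mult_cmul flip: v_def)
    moreover have "set (frag_cmul k (frag_of {\<one>\<^bsub>G\<^esub>}) # p)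
      \<subseteq> range (\<lambda>n. frag_cmul n (frag_of {\<one>\<^bsub>G\<^esub>}))"
      using p(1) by simp
    moreover have "length (frag_cmul k (frag_of {\<one>\<^bsub>G\<^esub>}) # p) = Suc n"
      using p(2) by simp
    ultimately show ?case by blast
  qed
  have "\<exists>k. v k \<in> frag.span (v ` {..<k})"
    by (rule frag_sequence_dependent[of "Pow (carrier G)"])
      (use assms(2) v_carrier in auto)
  then obtain k where "v k \<in> frag.span (v ` {..<k})" ..
  \<comment> \<open>The lower part has to take the value \<open>- v k\<close> at \<open>s\<close>
    for the monic polynomial of degree \<open>k\<close> to vanish there.\<close>
  then have "- v k \<in> frag.span (v ` {..<k})"
    by (rule frag.span_neg)
  then obtain p where p: "set p \<subseteq> range (\<lambda>n. frag_cmul n (frag_of {\<one>\<^bsub>G\<^esub>}))"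
    "length p = k" "eval p s = - v k"
    using combination by blast
  let ?p = "\<one>\<^bsub>?S\<^esub> # p"
  have "set ?p \<subseteq> K"
    using p(1) K K[of 1] by auto
  \<comment> \<open>Membership asks for coefficients in \<open>K\<close> and a nonzero head; the
    head \<open>frag_of {\<one>}\<close> is nonzero.\<close>
  then have "?p \<in> carrier (K[X]\<^bsub>?S\<^esub>)"
    by (simp add: univ_poly_def polynomial_def)
  moreover have "eval ?p s = \<zero>\<^bsub>?S\<^esub>"
    using l_one[OF v_carrier, of k] p by (simp flip: v_def)
  ultimately show ?thesis
    unfolding integral_over_def by (intro bexI[of _ ?p]) auto
qed

section \<open>Characters and their orthogonality\<close>

locale character_isomorphism = comm_group G for G :: "('a, 'm) monoid_scheme" (structure) +
  fixes T :: "'a \<Rightarrow> 'a \<Rightarrow> complex"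
  assumes finite_carrier: "finite (carrier G)"
    and T_iso: "T \<in> iso G (character_group G)"
begin

lemma T_character:
  assumes "g \<in> carrier G"
  shows "T g \<in> hom G complex_units" "T g \<in> extensional (carrier G)"
  using T_iso assms by (auto simp: iso_def hom_def character_group_def)

lemma T_nonzero:
  assumes "g \<in> carrier G" "x \<in> carrier G"
  shows "T g x \<noteq> 0"
  using T_character(1)[OF assms(1)] assms(2) by (auto simp: hom_def complex_units_def)

lemma T_mult_right:
  assumes "g \<in> carrier G" "x \<in> carrier G" "y \<in> carrier G"
  shows "T g (x \<otimes> y) = T g x * T g y"
  using T_character(1)[OF assms(1)] assms(2-) by (auto simp: hom_def complex_units_def)

lemma T_mult_left:
  assumes "g \<in> carrier G" "h \<in> carrier G" "x \<in> carrier G"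
  shows "T (g \<otimes> h) x = T g x * T h x"
  using T_iso assms by (auto simp: iso_def hom_def character_group_def)

text \<open>The value is a nonzero idempotent complex number.\<close>

lemma T_one_left:
  assumes "x \<in> carrier G"
  shows "T \<one> x = 1"
  using T_mult_left[of \<one> \<one> x] T_nonzero[of \<one> x] assms by simp

lemma T_bij: "bij_betw T (carrier G) (carrier (character_group G))"
  using T_iso by (simp add: iso_def)

text \<open>As \<open>T\<close> is injective, \<open>T g\<close> differs from the trivial character
  at some \<open>y\<close>. Translating the summation variable by \<open>y\<close> multiplies the
  sum by \<open>T g y\<close>, which is not 1.\<close>

lemma sum_T_eq_0:
  assumes g: "g \<in> carrier G" "g \<noteq> \<one>"
  shows "(\<Sum>x\<in>carrier G. T g x) = 0"
proof -
  have "T g \<noteq> T \<one>"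
    using T_bij g by (auto simp: bij_betw_def inj_on_def)
  then obtain y where y: "y \<in> carrier G" "T g y \<noteq> 1"
    using T_character(2) g T_one_left by (metis extensionalityI one_closed)
  have "(\<Sum>x\<in>carrier G. T g x) = (\<Sum>x\<in>carrier G. T g (y \<otimes> x))"
    by (rule sum.reindex_bij_witness[of _ "\<lambda>x. y \<otimes> x" "\<lambda>x. inv y \<otimes> x"])
      (use y in \<open>auto simp: m_assoc[symmetric]\<close>)
  also have "\<dots> = T g y * (\<Sum>x\<in>carrier G. T g x)"
    using g y by (simp add: T_mult_right sum_distrib_left)
  finally show ?thesis using y by simp
qed

section \<open>The representation ring in terms of integer coefficients\<close>

text \<open>Through \<open>T\<close> the coefficients are indexed by group elements, which matches
  the singletons in the glider ring. Values of \<open>c\<close> outside the carrier have no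
  influence, so \<open>c\<close> is determined on the carrier only.\<close>

definition virtual_character :: "('a \<Rightarrow> int) \<Rightarrow> 'a \<Rightarrow> complex" where
  "virtual_character c = (\<lambda>x\<in>carrier G. \<Sum>g\<in>carrier G. of_int (c g) * T g x)"

lemma carrier_representation_ring:
  "carrier (representation_ring G) = range virtual_character"
proof -
  let ?\<Phi> = "\<lambda>c. \<lambda>x\<in>carrier G. \<Sum>\<chi>\<in>carrier (character_group G). of_int (c \<chi>) * \<chi> x"
  have \<Phi>_eq: "?\<Phi> c = virtual_character (\<lambda>g. c (T g))" for c :: "('a \<Rightarrow> complex) \<Rightarrow> int"
    unfolding virtual_character_def
    by (intro restrict_ext sum.reindex_bij_betw[OF T_bij, symmetric])
  have eq_\<Phi>: "virtual_character c = ?\<Phi> (\<lambda>\<chi>. c (inv_into (carrier G) T \<chi>))" for c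
  proof -
    have "virtual_character c = virtual_character (\<lambda>g. c (inv_into (carrier G) T (T g)))"
      unfolding virtual_character_def
      using T_bij by (intro restrict_ext sum.cong) (auto simp: bij_betw_def)
    also have "\<dots> = ?\<Phi> (\<lambda>\<chi>. c (inv_into (carrier G) T \<chi>))"
      unfolding virtual_character_def
      by (intro restrict_ext sum.reindex_bij_betw[OF T_bij])
    finally show ?thesis .
  qed
  have "carrier (representation_ring G) = range ?\<Phi>"
    by (auto simp: representation_ring_def)
  also have "\<dots> = range virtual_character"
  proof (intro equalityI image_subsetI)
    show "?\<Phi> c \<in> range virtual_character" for c
      unfolding \<Phi>_eq by (rule rangeI)
    show "virtual_character c \<in> range ?\<Phi>" for c
      by (subst eq_\<Phi>) (rule rangeI)
  qed
  finally show ?thesis .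
qed

lemma virtual_character_cong:
  assumes "\<And>g. g \<in> carrier G \<Longrightarrow> c g = d g"
  shows "virtual_character c = virtual_character d"
  unfolding virtual_character_def using assms by (intro restrict_ext sum.cong) auto

text \<open>Fourier inversion: \<open>T (inv h)\<close> takes the place of the complex conjugate of
  \<open>T h\<close>. By \<open>sum_T_eq_0\<close> only the term \<open>g = h\<close>
  survives.\<close>

lemma coefficient_formula:
  assumes "h \<in> carrier G"
  shows "(\<Sum>x\<in>carrier G. virtual_character c x * T (inv h) x) = of_nat (order G) * of_int (c h)"
proof -
  have "(\<Sum>x\<in>carrier G. virtual_character c x * T (inv h) x)
    = (\<Sum>x\<in>carrier G. \<Sum>g\<in>carrier G. of_int (c g) * T (g \<otimes> inv h) x)"
    using assms by (simp add: virtual_character_def sum_distrib_right T_mult_left mult.assoc)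
  also have "\<dots> = (\<Sum>g\<in>carrier G. of_int (c g) * (\<Sum>x\<in>carrier G. T (g \<otimes> inv h) x))"
    by (subst sum.swap) (simp add: sum_distrib_left)
  also have "\<dots> = (\<Sum>g\<in>carrier G. if g = h then of_nat (order G) * of_int (c h) else 0)"
  proof (intro sum.cong refl)
    fix g assume g: "g \<in> carrier G"
    show "of_int (c g) * (\<Sum>x\<in>carrier G. T (g \<otimes> inv h) x)
      = (if g = h then of_nat (order G) * of_int (c h) else 0)"
    proof (cases "g = h")
      case True
      then show ?thesis using assms by (simp add: T_one_left order_def)
    next
      case False
      then have "g \<otimes> inv h \<noteq> \<one>"
        using assms g by (metis inv_closed inv_equality inv_inv)
      then show ?thesis using assms g False by (simp add: sum_T_eq_0)
    qed
  qed
  finally show ?thesis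
    using assms finite_carrier by simp
qed

lemma virtual_character_inject:
  assumes "virtual_character c = virtual_character d" "g \<in> carrier G"
  shows "c g = d g"
proof -
  have "order G \<noteq> 0"
    using order_gt_0_iff_finite finite_carrier by simp
  then show ?thesis
    using coefficient_formula[of g c] coefficient_formula[of g d] assms by simp
qed

text \<open>This is the multiplication of the integral group ring. Both
  \<open>virtual_character\<close> and \<open>singleton_combination\<close> carry it to the product
  of their ring.\<close>

definition convolution :: "('a \<Rightarrow> int) \<Rightarrow> ('a \<Rightarrow> int) \<Rightarrow> 'a \<Rightarrow> int" where
  "convolution c d k = (\<Sum>g\<in>carrier G. c g * d (inv g \<otimes> k))"

text \<open>Exchange the sums and substitute \<open>k = g \<otimes> h\<close>. The additive map
  \<open>u\<close> is left general because the identity serves twice, with complex values and with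
  values in the glider ring.\<close>

lemma sum_convolution:
  fixes u :: "'a \<Rightarrow> int \<Rightarrow> 'c :: comm_monoid_add"
  assumes u_0: "\<And>k. u k 0 = 0" and u_add: "\<And>k m n. u k (m + n) = u k m + u k n"
  shows "(\<Sum>k\<in>carrier G. u k (convolution c d k))
    = (\<Sum>g\<in>carrier G. \<Sum>h\<in>carrier G. u (g \<otimes> h) (c g * d h))"
proof -
  have u_sum: "u k (sum f I) = (\<Sum>i\<in>I. u k (f i))" for k and f :: "'a \<Rightarrow> int" and I
    by (induction I rule: infinite_finite_induct) (simp_all add: u_0 u_add)
  have "(\<Sum>k\<in>carrier G. u k (convolution c d k))
    = (\<Sum>g\<in>carrier G. \<Sum>k\<in>carrier G. u k (c g * d (inv g \<otimes> k)))"
    unfolding convolution_def u_sum by (rule sum.swap)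
  also have "\<dots> = (\<Sum>g\<in>carrier G. \<Sum>h\<in>carrier G. u (g \<otimes> h) (c g * d h))"
  proof (rule sum.cong[OF refl])
    fix g assume g: "g \<in> carrier G"
    show "(\<Sum>k\<in>carrier G. u k (c g * d (inv g \<otimes> k)))
      = (\<Sum>h\<in>carrier G. u (g \<otimes> h) (c g * d h))"
      by (rule sum.reindex_bij_witness[of _ "\<lambda>h. g \<otimes> h" "\<lambda>k. inv g \<otimes> k"])
        (use g in \<open>auto simp: m_assoc[symmetric]\<close>)
  qed
  finally show ?thesis .
qed

lemma representation_ring_simps [simp]:
  "\<one>\<^bsub>representation_ring G\<^esub> = virtual_character (\<lambda>g. if g = \<one> then 1 else 0)"
  "\<zero>\<^bsub>representation_ring G\<^esub> = virtual_character (\<lambda>_. 0)"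
  "virtual_character c \<oplus>\<^bsub>representation_ring G\<^esub> virtual_character d
    = virtual_character (\<lambda>g. c g + d g)"
  "virtual_character c \<otimes>\<^bsub>representation_ring G\<^esub> virtual_character d
    = virtual_character (convolution c d)"
proof -
  show "\<one>\<^bsub>representation_ring G\<^esub> = virtual_character (\<lambda>g. if g = \<one> then 1 else 0)"
    using finite_carrier
    by (auto simp: representation_ring_def virtual_character_def T_one_left if_distrib[of of_int]
        if_distrib[of "\<lambda>z. z * _"] cong: if_cong intro!: restrict_ext)
  show "\<zero>\<^bsub>representation_ring G\<^esub> = virtual_character (\<lambda>_. 0)"
    by (simp add: representation_ring_def virtual_character_def)
  show "virtual_character c \<oplus>\<^bsub>representation_ring G\<^esub> virtual_character d
    = virtual_character (\<lambda>g. c g + d g)"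
    by (auto simp: representation_ring_def virtual_character_def sum.distrib distrib_right
        intro!: restrict_ext)
  have "(\<Sum>g\<in>carrier G. of_int (c g) * T g x) * (\<Sum>g\<in>carrier G. of_int (d g) * T g x)
    = (\<Sum>k\<in>carrier G. of_int (convolution c d k) * T k x)" if "x \<in> carrier G" for x
    using that
    by (subst sum_convolution[where u = "\<lambda>k n. of_int n * T k x"])
      (simp_all add: sum_product T_mult_left algebra_simps)
  then show "virtual_character c \<otimes>\<^bsub>representation_ring G\<^esub> virtual_character d
    = virtual_character (convolution c d)"
    by (auto simp: representation_ring_def virtual_character_def intro!: restrict_ext)
qed

lemma T_eq_virtual_character:
  assumes "g \<in> carrier G"
  shows "T g = virtual_character (\<lambda>h. if h = g then 1 else 0)"
proof (rule extensionalityI[of _ "carrier G"])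
  show "T g x = virtual_character (\<lambda>h. if h = g then 1 else 0) x" if "x \<in> carrier G" for x
    using that assms finite_carrier
    by (simp add: virtual_character_def if_distrib[of of_int] if_distrib[of "\<lambda>z. z * _"] cong: if_cong)
qed (simp_all add: T_character assms virtual_character_def)

text \<open>Closure and negatives come from the coefficients. The other laws hold pointwise in the
  complex numbers; extensionality of the elements makes the neutral elements act as identities of
  functions.\<close>

lemma cring_representation_ring: "cring (representation_ring G)"
proof -
  let ?R = "representation_ring G"
  have mult: "F \<otimes>\<^bsub>?R\<^esub> H = (\<lambda>x\<in>carrier G. F x * H x)"
    and add: "F \<oplus>\<^bsub>?R\<^esub> H = (\<lambda>x\<in>carrier G. F x + H x)"
    and one: "\<one>\<^bsub>?R\<^esub> = (\<lambda>x\<in>carrier G. 1)"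
    and zero: "\<zero>\<^bsub>?R\<^esub> = (\<lambda>x\<in>carrier G. 0)" for F H
    by (simp_all add: representation_ring_def)
  have ext: "F \<in> extensional (carrier G)" if "F \<in> carrier ?R" for F
    using that by (auto simp: carrier_representation_ring virtual_character_def)
  have closed: "F \<oplus>\<^bsub>?R\<^esub> H \<in> carrier ?R" "F \<otimes>\<^bsub>?R\<^esub> H \<in> carrier ?R"
    if "F \<in> carrier ?R" "H \<in> carrier ?R" for F H
    using that unfolding carrier_representation_ring by auto
  have closed_0_1: "\<zero>\<^bsub>?R\<^esub> \<in> carrier ?R" "\<one>\<^bsub>?R\<^esub> \<in> carrier ?R"
    unfolding carrier_representation_ring by simp_all
  show ?thesis
  proof (rule cringI)
    show "abelian_group ?R"
    proof (rule abelian_groupI)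
      fix F assume "F \<in> carrier ?R"
      then obtain c where F: "F = virtual_character c"
        unfolding carrier_representation_ring by auto
      show "\<exists>H\<in>carrier ?R. H \<oplus>\<^bsub>?R\<^esub> F = \<zero>\<^bsub>?R\<^esub>"
        by (rule bexI[of _ "virtual_character (\<lambda>g. - c g)"])
          (simp_all add: F carrier_representation_ring)
    next
      fix F assume "F \<in> carrier ?R"
      then show "\<zero>\<^bsub>?R\<^esub> \<oplus>\<^bsub>?R\<^esub> F = F"
        unfolding add zero by (intro extensionalityI[OF _ ext]) auto
    qed (simp_all only: closed closed_0_1, auto simp: add add_ac intro!: restrict_ext)
    show "Group.comm_monoid ?R"
    proof (rule comm_monoidI)
      fix F assume "F \<in> carrier ?R"
      then show "\<one>\<^bsub>?R\<^esub> \<otimes>\<^bsub>?R\<^esub> F = F"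
        unfolding mult one by (intro extensionalityI[OF _ ext]) auto
    qed (simp_all only: closed closed_0_1, auto simp: mult mult_ac intro!: restrict_ext)
  qed (auto simp: add mult distrib_right intro!: restrict_ext)
qed

section \<open>The ring morphism \<iota>\<close>

text \<open>This is the value that \<iota> must take at \<open>virtual_character c\<close>.\<close>

definition singleton_combination :: "('a \<Rightarrow> int) \<Rightarrow> ('a set \<Rightarrow>\<^sub>0 int)" where
  "singleton_combination c = (\<Sum>g\<in>carrier G. frag_cmul (c g) (frag_of {g}))"

lemma lookup_singleton_combination:
  assumes "g \<in> carrier G"
  shows "Poly_Mapping.lookup (singleton_combination c) {g} = c g"
  using assms finite_carrier
  by (simp add: singleton_combination_def lookup_sum if_distrib cong: if_cong)

lemma singleton_combination_single:
  assumes "g \<in> carrier G"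
  shows "singleton_combination (\<lambda>h. if h = g then n else 0) = frag_cmul n (frag_of {g})"
proof -
  have "singleton_combination (\<lambda>h. if h = g then n else 0)
    = (\<Sum>h\<in>carrier G. if h = g then frag_cmul n (frag_of {g}) else 0)"
    unfolding singleton_combination_def by (rule sum.cong) auto
  then show ?thesis using assms finite_carrier by simp
qed

text \<open>A product of singletons is a singleton, so the correction 1 * 1 - 1 vanishes and the
  group ring multiplication remains.\<close>

lemma glider_mult_singleton_combination:
  "glider_mult G (singleton_combination c) (singleton_combination d)
    = singleton_combination (convolution c d)"
proof -
  have basis: "glider_basis_mult G {g} {h} = frag_of {g \<otimes> h}" for g h
    by (simp add: glider_basis_mult_def set_mult_def)
  have "singleton_combination (convolution c d)
    = (\<Sum>g\<in>carrier G. \<Sum>h\<in>carrier G. frag_cmul (c g * d h) (frag_of {g \<otimes> h}))"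
    unfolding singleton_combination_def
    by (rule sum_convolution[where u = "\<lambda>k n. frag_cmul n (frag_of {k})"])
      (simp_all add: frag_cmul_distrib)
  then show ?thesis
    unfolding singleton_combination_def glider_mult_sum(1)
    by (simp add: glider_mult_sum(2) glider_mult_cmul basis mult.commute)
qed

lemma singleton_combination_in_carrier:
  "singleton_combination c \<in> carrier (glider_character_ring G)"
  unfolding singleton_combination_def using keys_sum by fastforce

lemma ex_ring_hom:
  "\<exists>\<iota> \<in> ring_hom (representation_ring G) (glider_character_ring G).
     \<forall>g\<in>carrier G. \<iota> (T g) = frag_of {g}"
proof -
  \<comment> \<open>The choice of \<open>c\<close> is harmless: by
    \<open>virtual_character_inject\<close> any two candidates agree on the carrier, and
    \<open>singleton_combination\<close> reads no other values.\<close>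
  define \<iota> where "\<iota> F = singleton_combination (SOME c. virtual_character c = F)" for F
  have \<iota>: "\<iota> (virtual_character c) = singleton_combination c" for c
  proof -
    have "virtual_character (SOME d. virtual_character d = virtual_character c) = virtual_character c"
      by (rule someI[of _ c]) simp
    then show ?thesis
      unfolding \<iota>_def singleton_combination_def
      by (intro sum.cong) (auto dest: virtual_character_inject)
  qed
  have "\<iota> \<in> ring_hom (representation_ring G) (glider_character_ring G)"
    by (rule ring_hom_memI)
      (auto simp: carrier_representation_ring \<iota> singleton_combination_in_carrier
        glider_mult_singleton_combination singleton_combination_single
        simp del: glider_character_ring_simps(1),
       simp add: singleton_combination_def frag_cmul_distrib sum.distrib)
  then show ?thesis
    by (intro bexI[of _ \<iota>]) (simp_all add: T_eq_virtual_character \<iota> singleton_combination_single)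
qed

text \<open>Additivity and the values at the \<open>T g\<close> determine \<iota>: first on integer
  multiples of one \<open>T g\<close>, then on sums, adding one group element at a time.\<close>

lemma ring_hom_virtual_character:
  assumes hom: "\<iota> \<in> ring_hom (representation_ring G) (glider_character_ring G)"
    and \<iota>_T: "\<And>g. g \<in> carrier G \<Longrightarrow> \<iota> (T g) = frag_of {g}"
  shows "\<iota> (virtual_character c) = singleton_combination c"
proof -
  have add: "\<iota> (virtual_character (\<lambda>g. c g + d g)) = \<iota> (virtual_character c) + \<iota> (virtual_character d)" for c d
    using ring_hom_add[OF hom, of "virtual_character c" "virtual_character d"]
    by (simp add: carrier_representation_ring)
  \<comment> \<open>Preservation of zero is not part of \<open>ring_hom\<close>; it follows from
    additivity by cancellation.\<close>
  have zero: "\<iota> (virtual_character (\<lambda>_. 0)) = 0"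
    using add[of "\<lambda>_. 0" "\<lambda>_. 0"] by simp
  have single: "\<iota> (virtual_character (\<lambda>h. if h = g then n else 0)) = frag_cmul n (frag_of {g})"
    if "g \<in> carrier G" for g n
  proof -
    let ?u = "\<lambda>n. \<iota> (virtual_character (\<lambda>h. if h = g then n else 0))"
    have u_add: "?u (m + n) = ?u m + ?u n" for m n
      using add[of "\<lambda>h. if h = g then m else 0" "\<lambda>h. if h = g then n else 0"]
      by (simp add: if_distrib cong: if_cong)
    have u_1: "?u 1 = frag_of {g}"
      using that \<iota>_T T_eq_virtual_character by simp
    show ?thesis
    proof (induction n rule: int_induct[of _ 0])
      case base
      show ?case using zero by simp
    next
      case (step1 i)
      then show ?case using u_1 by (simp add: u_add frag_cmul_distrib)
    next
      case (step2 i)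
      have "?u i = ?u (i - 1) + frag_of {g}"
        using u_add[of "i - 1" 1] u_1 by (simp only: diff_add_cancel)
      then show ?case using step2 by (simp add: frag_cmul_diff_distrib eq_diff_eq)
    qed
  qed
  have "\<iota> (virtual_character (\<lambda>g. if g \<in> I then c g else 0))
    = (\<Sum>g\<in>I. frag_cmul (c g) (frag_of {g}))" if "finite I" "I \<subseteq> carrier G" for I
    using that
  proof (induction I rule: finite_induct)
    case empty
    show ?case using zero by simp
  next
    case (insert a I)
    have "(\<lambda>g. if g \<in> insert a I then c g else 0)
      = (\<lambda>g. (if g = a then c a else 0) + (if g \<in> I then c g else 0))"
      using insert.hyps by auto
    then show ?case
      using insert by (simp add: add single)
  qed
  from this[of "carrier G"] show ?thesis
    using finite_carrier virtual_character_cong[of c "\<lambda>g. if g \<in> carrier G then c g else 0"]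
    by (simp add: singleton_combination_def)
qed

text \<open>The coefficient of the image at \<open>{g}\<close> gives back \<open>c g\<close>, whence
  injectivity. Multiples of the trivial character map to the integer multiples of the unit, so
  integrality over the integers applies to the image.\<close>

lemma integral_ring_extension_ring_hom:
  assumes hom: "\<iota> \<in> ring_hom (representation_ring G) (glider_character_ring G)"
    and \<iota>_T: "\<And>g. g \<in> carrier G \<Longrightarrow> \<iota> (T g) = frag_of {g}"
  shows "integral_ring_extension (representation_ring G) (glider_character_ring G) \<iota>"
proof -
  have \<iota>: "\<iota> (virtual_character c) = singleton_combination c" for c
    using ring_hom_virtual_character assms by blast
  have "inj_on \<iota> (carrier (representation_ring G))"
    unfolding carrier_representation_ring
    by (auto simp: inj_on_def \<iota>) (metis lookup_singleton_combination virtual_character_cong)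
  moreover have "frag_cmul n (frag_of {\<one>}) \<in> \<iota> ` carrier (representation_ring G)" for n
    using \<iota>[of "\<lambda>h. if h = \<one> then n else 0"]
    unfolding carrier_representation_ring singleton_combination_single[OF one_closed]
    by (metis rangeI image_eqI)
  ultimately show ?thesis
    unfolding integral_ring_extension_def
    using hom cring_representation_ring cring_glider_character_ring[OF comm_group_axioms]
      integral_over_glider_character_ring[OF comm_group_axioms finite_carrier] by blast
qed

end

text \<open>Existence accompanies the claim about every such \<iota>, so that the latter is not
  vacuous.\<close>

theorem proposition4p5:
  fixes G :: "('a, 'm) monoid_scheme" and T :: "'a \<Rightarrow> 'a \<Rightarrow> complex"
  assumes "comm_group G" and "finite (carrier G)"
    and "T \<in> iso G (character_group G)"
  shows "(\<exists>\<iota>. \<iota> \<in> ring_hom (representation_ring G) (glider_character_ring G) \<and>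
             (\<forall>g\<in>carrier G. \<iota> (T g) = frag_of {g})) \<and>
         (\<forall>\<iota>. \<iota> \<in> ring_hom (representation_ring G) (glider_character_ring G) \<and>
             (\<forall>g\<in>carrier G. \<iota> (T g) = frag_of {g}) \<longrightarrow>
             integral_ring_extension (representation_ring G) (glider_character_ring G) \<iota>)"
proof -
  interpret character_isomorphism G T
    using assms by (simp add: character_isomorphism_def character_isomorphism_axioms_def)
  show ?thesis
    using ex_ring_hom integral_ring_extension_ring_hom by blast
qed

end
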